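(* Let $(\alpha,\beta,\gamma)\in\{(1,2,3),(1,2,5),(1,2,7),(1,3,4),(1,3,5)\}$. For all integers $k\ge 1$ and $n\ge k(3k+1)/2$, we have ${\rm TP}_{\alpha,\beta,\gamma}^{k}(n)\ge 0$, with strict inequality except for the following cases, in which the value is $0$: \begin{align*} &{\rm TP}_{1,2,3}^{1}(n)=0\ \text{ for } n=13;\\ &{\rm TP}_{1,2,5}^{1}(n)=0\ \text{ for } n=11,13,15;\\ &{\rm TP}_{1,2,7}^{1}(n)=0\ \text{ for } n=7,9,11,13,14,15;\\ &{\rm TP}_{1,3,4}^{1}(n)=0\ \text{ for } n=11,13,14,17,38,41;\\ &{\rm TP}_{1,3,5}^{1}(n)=0\ \text{ for } n=10,11,13,14,16,37. \end{align*} In particular, ${\rm TP}_{\alpha,\beta,\gamma}^{k}(n)>0$ for all integers $k>1$ and $n\ge k(3k+1)/2$.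
   Context: For distinct pairwise coprime integers $\alpha,\beta,\gamma\ge 1$ and an integer $k\ge 1$, the integers ${\rm TP}_{\alpha,\beta,\gamma}^{k}(n)$ ($n\ge 0$) are defined by the formal power series identity $$\sum_{n\ge 0}{\rm TP}_{\alpha,\beta,\gamma}^{k}(n)q^n=\frac{(-1)^k}{(1-q^\alpha)(1-q^\beta)(1-q^\gamma)}\sum_{j\ge k}(-1)^jq^{j(3j+1)/2}\left(1-q^{2j+1}\right).$$ *)

theory Defs
  imports "HOL-Computational_Algebra.Computational_Algebra"
begin

definition TP_denom :: "nat \<Rightarrow> nat \<Rightarrow> nat \<Rightarrow> int fps" where
  "TP_denom \<alpha> \<beta> \<gamma> = (1 - fps_X ^ \<alpha>) * (1 - fps_X ^ \<beta>) * (1 - fps_X ^ \<gamma>)"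

(* j * (3 * j + 1) is always even, so the natural-number division is exact. *)
definition TP_term :: "nat \<Rightarrow> int fps" where
  "TP_term j = (-1) ^ j * fps_X ^ (j * (3 * j + 1) div 2) * (1 - fps_X ^ (2 * j + 1))"

(* The sum over j >= k is the sum over i >= 0 with j = k + i, taken in the q-adic metric on
   formal power series.  The coefficients are kept in int, where the library has no division of
   power series; fps_right_inverse D 1 is the inverse of a series D whose constant coefficient
   is 1.  Meaningful for \<alpha>, \<beta>, \<gamma> >= 1 only: see TP_term_summable and
   TP_series_identity below. *)
definition TP_series :: "nat \<Rightarrow> nat \<Rightarrow> nat \<Rightarrow> nat \<Rightarrow> int fps" where
  "TP_series \<alpha> \<beta> \<gamma> k =
     (-1) ^ k * fps_right_inverse (TP_denom \<alpha> \<beta> \<gamma>) 1 * (\<Sum>i. TP_term (k + i))"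

definition TP :: "nat \<Rightarrow> nat \<Rightarrow> nat \<Rightarrow> nat \<Rightarrow> nat \<Rightarrow> int" where
  "TP \<alpha> \<beta> \<gamma> k n = fps_nth (TP_series \<alpha> \<beta> \<gamma> k) n"

lemma TP_series_identity:
  assumes "\<alpha> \<ge> 1" "\<beta> \<ge> 1" "\<gamma> \<ge> 1"
  shows "TP_denom \<alpha> \<beta> \<gamma> * TP_series \<alpha> \<beta> \<gamma> k = (-1) ^ k * (\<Sum>i. TP_term (k + i))"
proof -
  have "fps_nth (TP_denom \<alpha> \<beta> \<gamma>) 0 * 1 = 1"
    using assms by (simp add: TP_denom_def)
  then have "TP_denom \<alpha> \<beta> \<gamma> * fps_right_inverse (TP_denom \<alpha> \<beta> \<gamma>) 1 = 1"
    by (rule fps_right_inverse)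
  then have "TP_denom \<alpha> \<beta> \<gamma> * (c * fps_right_inverse (TP_denom \<alpha> \<beta> \<gamma>) 1 * S) = c * S" for c S
    by (simp only: mult.left_commute[of _ c] mult.assoc[of c]) (simp flip: mult.assoc)
  then show ?thesis
    by (simp only: TP_series_def)
qed

lemma TP_term_nth_eq_0: "n < j \<Longrightarrow> fps_nth (TP_term j) n = 0"
proof -
  assume "n < j"
  have "j * 2 \<le> j * (3 * j + 1)"
    by (cases j) auto
  then have "j \<le> j * (3 * j + 1) div 2"
    by linarith
  with \<open>n < j\<close> have "n < j * (3 * j + 1) div 2"
    by linarith
  moreover have "TP_term j = fps_X ^ (j * (3 * j + 1) div 2) * ((-1) ^ j * (1 - fps_X ^ (2 * j + 1)))"
    by (simp add: TP_term_def ac_simps)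
  ultimately show ?thesis
    by (simp only: fps_X_power_mult_nth if_True)
qed

lemma TP_term_summable: "summable (\<lambda>i. TP_term (k + i))"
proof -
  define S where "S = Abs_fps (\<lambda>n. \<Sum>i\<le>n. fps_nth (TP_term (k + i)) n)"
  have "(\<lambda>m. \<Sum>i<m. TP_term (k + i)) \<longlonglongrightarrow> S"
  proof (rule tendsto_fpsI)
    fix n
    have "fps_nth (\<Sum>i<m. TP_term (k + i)) n = fps_nth S n" if "m > n" for m
    proof -
      have "(\<Sum>i<m. fps_nth (TP_term (k + i)) n) = (\<Sum>i\<le>n. fps_nth (TP_term (k + i)) n)"
        using that by (intro sum.mono_neutral_right) (auto simp: TP_term_nth_eq_0)
      then show ?thesis
        by (simp add: S_def fps_sum_nth)
    qed
    then show "eventually (\<lambda>m. fps_nth (\<Sum>i<m. TP_term (k + i)) n = fps_nth S n) sequentially"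
      by (rule eventually_mono[OF eventually_gt_at_top[of n]])
  qed
  then show ?thesis
    by (auto simp: summable_def sums_def)
qed

end

theory Submission
  imports Defs
begin

text \<open>
  Let \<open>p m\<close> be the number of partitions of \<open>m\<close> into parts \<open>1, b, g\<close>, let \<open>s = 1 + b + g\<close>, and let
  \<open>w j = j (3 j + 1) / 2\<close>.  The sequence \<open>T k\<close> satisfies
  \<open>T k n = p (n - w k) - p (n - w k - (2 k + 1)) - T (k + 1) n\<close>.  For each of the five triples,
  \<open>p m\<close> is the integer part of a quadratic polynomial, and \<open>2 b g p m\<close> differs from
  \<open>(m + s / 2)\<^sup>2\<close> by a bounded periodic error.  On the quadratic part the alternating sum telescopes,
  through \<open>H j = j (2 n + s + 2 - 3 j\<^sup>2)\<close>.  If \<open>w J \<le> n < w (J + 1)\<close>, this leaves the main term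
  \<open>H k\<close>, a term of size at most about \<open>2 J\<^sup>2\<close> from the cut-off at \<open>J\<close>, and an error linear in \<open>J - k\<close>;
  the main term is at least about \<open>3 k J\<^sup>2\<close> when \<open>J\<close> is large and wins except when \<open>k = 1\<close> and
  \<open>J\<close> is at most 23, or \<open>k = 2\<close> and \<open>J\<close> is at most 5, or \<open>J = k\<close>.  The last case is monotonicity of
  \<open>p\<close>; the others are finitely many values, computed by additions only, by dividing successively by
  \<open>1 - q\<close>, \<open>1 - q\<^sup>b\<close> and \<open>1 - q\<^sup>g\<close>.
\<close>

section \<open>Pentagonal exponents and power series division on lists\<close>

definition pent :: "int \<Rightarrow> int" where
  "pent j = j * (3 * j + 1) div 2"

lemma two_pent: "2 * pent j = j * (3 * j + 1)"
proof -
  have "even (j * (3 * j + 1))" by simp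
  then show ?thesis unfolding pent_def by (rule dvd_mult_div_cancel)
qed

lemma pent_Suc: "pent (j + 1) = pent j + 3 * j + 2"
proof -
  have "2 * pent (j + 1) = 2 * (pent j + 3 * j + 2)"
    using two_pent[of j] two_pent[of "j + 1"] by (simp add: algebra_simps)
  then show ?thesis by simp
qed

lemma pent_of_nat: "pent (int j) = int (j * (3 * j + 1) div 2)"
  by (simp add: pent_def zdiv_int algebra_simps)

lemma pent_ge: "j \<ge> 0 \<Longrightarrow> pent j \<ge> j"
proof -
  assume "j \<ge> 0"
  then have "2 * j \<le> j * (3 * j + 1)"
    by (cases "j = 0") (auto intro: mult_mono simp: mult.commute)
  then show ?thesis using two_pent[of j] by linarith
qed

text \<open>Division by \<open>1 - q\<^sup>d\<close> on coefficient lists; the window \<open>w\<close> holds the last \<open>d\<close> output values.\<close>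

primrec lag_sum :: "int list \<Rightarrow> int list \<Rightarrow> int list" where
  "lag_sum w [] = []"
| "lag_sum w (x # xs) = (let y = hd w + x in y # lag_sum (tl w @ [y]) xs)"

text \<open>The induction advances the start \<open>a\<close>: the window loses its head
  \<open>f (a - int d)\<close>, just used in the recurrence, and gains \<open>f a\<close> at its
  end.\<close>

lemma lag_sum_map:
  fixes f u :: "int \<Rightarrow> int"
  assumes "\<And>n. n \<ge> a \<Longrightarrow> f n = f (n - int d) + u n" "d > 0"
  shows "lag_sum (map f [a - int d..a - 1]) (map u [a..e]) = map f [a..e]"
  using assms
proof (induction "nat (e - a + 1)" arbitrary: a)
  case 0
  then show ?case by simp
next
  case (Suc m)
  then have "a \<le> e" by simp
  have w: "map f [a - int d..a - 1] = f (a - int d) # map f [a - int d + 1..a - 1]"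
    using \<open>d > 0\<close> by (subst upto_rec1) auto
  have "lag_sum (map f [a + 1 - int d..a + 1 - 1]) (map u [a + 1..e]) = map f [a + 1..e]"
    by (rule Suc.hyps(1)) (use Suc in auto)
  moreover have "map f [a + 1 - int d..a + 1 - 1] = map f [a - int d + 1..a - 1] @ [f a]"
    using \<open>d > 0\<close> by (subst upto_rec2) (auto simp: algebra_simps)
  ultimately show ?case
    using \<open>a \<le> e\<close> Suc.prems(1)[of a] by (simp add: w upto_rec1[of a e] Let_def)
qed

text \<open>
  For \<open>s = 1\<close>, the coefficients of
  \<open>(\<Sum>j\<ge>k. (-1)\<^sup>j\<^sup>-\<^sup>k q\<^bsup>pent j\<^esup> (1 - q\<^sup>2\<^sup>j\<^sup>+\<^sup>1)) / (1 - q)\<close> from \<open>pent k\<close> to \<open>pent (k + m) - 1\<close>.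
\<close>

primrec blocks :: "int \<Rightarrow> int \<Rightarrow> nat \<Rightarrow> int list" where
  "blocks s k 0 = []"
| "blocks s k (Suc m) = map (\<lambda>_. s) [1..2 * k + 1] @ map (\<lambda>_. 0) [1..k + 1] @ blocks (-s) (k + 1) m"

definition values_from :: "nat \<Rightarrow> nat \<Rightarrow> int \<Rightarrow> nat \<Rightarrow> int list" where
  "values_from b g k m = lag_sum (replicate g 0) (lag_sum (replicate b 0) (blocks 1 k m))"

section \<open>Floor formula for partitions into parts 1, b, g\<close>

text \<open>The cut-off at negative \<open>m\<close> lets shifted arguments stand for missing
  coefficients.\<close>

definition denum :: "nat \<Rightarrow> nat \<Rightarrow> int \<Rightarrow> int \<Rightarrow> int" where
  "denum b g c m =
     (if m < 0 then 0 else (m * m + (1 + int b + int g) * m + c) div (2 * int b * int g))"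

text \<open>The shift changes the numerator by a multiple of the divisor, so the floor moves by an
  exact integer. Checks over one period then cover all \<open>m\<close>.\<close>

lemma denum_periodic:
  assumes "m \<ge> 0" "t \<ge> 0" "b > 0" "g > 0"
  shows "denum b g c (2 * int b * int g * t + m) =
    denum b g c m + t * (2 * int b * int g * t + 2 * m + (1 + int b + int g))"
proof -
  define A where "A = 2 * int b * int g"
  define s where "s = 1 + int b + int g"
  have "A > 0" using assms by (simp add: A_def)
  have "(A * t + m) * (A * t + m) + s * (A * t + m) + c = (m * m + s * m + c) + A * (t * (A * t + 2 * m + s))"
    by (simp add: algebra_simps)
  with \<open>A > 0\<close> have "((A * t + m) * (A * t + m) + s * (A * t + m) + c) div A = (m * m + s * m + c) div A + t * (A * t + 2 * m + s)"
    by (simp only: div_mult_self2)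
  moreover have "A * t + m \<ge> 0" using assms \<open>A > 0\<close> by simp
  ultimately show ?thesis
    using assms(1) by (simp add: denum_def flip: A_def s_def)
qed

lemma one_minus_X_power_nth:
  "fps_nth ((1 - fps_X ^ d) * G) n = fps_nth G n - (if n < d then 0 else fps_nth (G :: int fps) (n - d))"
  by (simp add: left_diff_distrib fps_X_power_mult_nth)

text \<open>
  In the instances, \<open>c\<close> and \<open>l\<close> are the maximum and the minimum of
  \<open>2 b g p m - m\<^sup>2 - (1 + b + g) m\<close>.  The floor formula needs \<open>c - l < 2 b g\<close>; it is verified
  through the lag condition over one period.
\<close>

locale three_part_denumerant =
  fixes b g :: nat and c l :: int
  assumes b_pos: "b > 0" and g_pos: "g > 0"
    and denum_lag_residues: "\<forall>i\<in>set [0..2 * int b * int g + int g - 1].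
      denum b g c i - denum b g c (i - int g) = i div int b + 1"
    and denum_lower_residues: "\<forall>i\<in>set [0..2 * int b * int g - 1].
      i * i + (1 + int b + int g) * i + l \<le> 2 * int b * int g * denum b g c i"
    and spread: "0 \<le> c - l" "c - l \<le> 23"
    and centred: "4 * l \<le> (1 + int b + int g)\<^sup>2" "(1 + int b + int g)\<^sup>2 \<le> 4 * c"
    and span: "6 \<le> 1 + int b + int g" "1 + int b + int g \<le> 10"
    and period: "2 * int b * int g \<le> 25 + 5 * (1 + int b + int g)" "2 * int b * int g \<le> c"
begin

abbreviation "A \<equiv> 2 * int b * int g"
abbreviation "s \<equiv> 1 + int b + int g"
abbreviation "p \<equiv> denum b g c"

lemma A_pos: "A > 0" using b_pos g_pos by simp

text \<open>The right side counts partitions into parts 1 and b. Both sides grow alike under a shift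
  by \<open>A\<close>. The checked range has \<open>A + int g\<close> entries because for
  \<open>m < int g\<close> the cut-off acts, and periodicity starts only after that.\<close>

lemma p_lag: assumes "m \<ge> 0" shows "p m - p (m - int g) = m div int b + 1"
proof (cases "m < A + int g")
  case True
  then show ?thesis using denum_lag_residues assms by simp
next
  case False
  define i t where "i = (m - int g) mod A" and "t = (m - int g) div A"
  have i: "0 \<le> i" "i < A" using A_pos by (simp_all add: i_def)
  have t: "t \<ge> 0" using False A_pos by (simp add: t_def pos_imp_zdiv_nonneg_iff)
  have m: "m - int g = A * t + i" by (simp add: i_def t_def)
  have m': "m = A * t + (i + int g)" using m by simp
  have "p m = p (i + int g) + t * (A * t + 2 * (i + int g) + s)"
    unfolding m' using i t b_pos g_pos by (intro denum_periodic) auto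
  moreover have "p (m - int g) = p i + t * (A * t + 2 * i + s)"
    unfolding m using i t b_pos g_pos by (intro denum_periodic) auto
  moreover have "p (i + int g) - p i = (i + int g) div int b + 1"
    using denum_lag_residues[rule_format, of "i + int g"] i g_pos by simp
  moreover have "m div int b = (i + int g) div int b + 2 * int g * t"
  proof -
    have "m = (i + int g) + int b * (2 * int g * t)" using m' by simp
    then show ?thesis using b_pos by (simp only: div_mult_self2)
  qed
  ultimately show ?thesis by (simp add: algebra_simps)
qed

text \<open>\<open>A * p m - m * m - s * m\<close> has period \<open>A\<close>, so its minimum over
  one period is a global bound.\<close>

lemma p_lower: assumes "m \<ge> 0" shows "m * m + s * m + l \<le> A * p m"
proof -
  define i t where "i = m mod A" and "t = m div A"
  have i: "0 \<le> i" "i < A" using A_pos by (simp_all add: i_def)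
  have t: "t \<ge> 0" using assms A_pos by (simp add: t_def pos_imp_zdiv_nonneg_iff)
  have m: "m = A * t + i" by (simp add: i_def t_def)
  have "p m = p i + t * (A * t + 2 * i + s)"
    unfolding m using i t b_pos g_pos by (intro denum_periodic) auto
  then have "A * p m = A * p i + A * (t * (A * t + 2 * i + s))"
    by (simp only: distrib_left)
  also have "A * (t * (A * t + 2 * i + s)) = m * m + s * m - (i * i + s * i)"
    unfolding m by (simp add: algebra_simps)
  finally show ?thesis
    using denum_lower_residues[rule_format, of i] i by simp
qed

lemma p_upper: assumes "m \<ge> 0" shows "A * p m \<le> m * m + s * m + c"
proof -
  have "A * ((m * m + s * m + c) div A) \<le> m * m + s * m + c"
    using A_pos mult_div_mod_eq[of A "m * m + s * m + c"] pos_mod_sign[of A "m * m + s * m + c"]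
    by linarith
  then show ?thesis using assms by (simp add: denum_def)
qed

lemma p_pos: assumes "m \<ge> 0" shows "p m > 0"
proof -
  have "A \<le> m * m + s * m + c" using assms period(2) by (simp add: add_increasing)
  then show ?thesis using assms A_pos by (simp add: denum_def pos_imp_zdiv_pos_iff)
qed

text \<open>The numerator grows by at least \<open>d * d + s * d\<close>, hence by at least
  \<open>25 + 5 * s\<close>, which \<open>period\<close> makes at least \<open>A\<close>. The bound
  5 is the smallest \<open>2 * k + 1\<close> with \<open>k\<close> at least 2.\<close>

lemma p_increase: assumes "m \<ge> 0" "d \<ge> 5" shows "p m < p (m + d)"
proof -
  have "25 \<le> d * d" using mult_mono[of 5 d 5 d] assms by simp
  moreover have "5 * s \<le> s * d" using mult_left_mono[of 5 d s] assms by simp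
  moreover have "0 \<le> m * d" using assms by simp
  ultimately have "(m * m + s * m + c) + A * 1 \<le> (m + d) * (m + d) + s * (m + d) + c"
    using period(1) by (simp add: algebra_simps)
  then have "((m * m + s * m + c) + A * 1) div A \<le> ((m + d) * (m + d) + s * (m + d) + c) div A"
    using A_pos by (intro zdiv_mono1) auto
  then have "(m * m + s * m + c) div A + 1 \<le> ((m + d) * (m + d) + s * (m + d) + c) div A"
    using A_pos by (simp only: div_mult_self2)
  then show ?thesis using assms by (simp add: denum_def)
qed

text \<open>This identifies the floor formula with the partition count: multiplying its series by 1
  - q^g, 1 - q^b and 1 - q in turn gives \<open>R\<close>, the all-ones series and 1.\<close>

lemma inverse_denom:
  "fps_right_inverse (TP_denom 1 b g) 1 = Abs_fps (\<lambda>n. p (int n))" (is "_ = ?P")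
proof -
  define R where "R = Abs_fps (\<lambda>n. int (n div b) + 1)"
  have "(1 - fps_X ^ g) * ?P = R"
  proof (rule fps_ext)
    fix n
    show "fps_nth ((1 - fps_X ^ g) * ?P) n = fps_nth R n"
      using p_lag[of "int n"] unfolding one_minus_X_power_nth
      by (auto simp: R_def zdiv_int of_nat_diff denum_def)
  qed
  moreover have "(1 - fps_X ^ b) * R = Abs_fps (\<lambda>_. 1)"
  proof (rule fps_ext)
    fix n
    show "fps_nth ((1 - fps_X ^ b) * R) n = fps_nth (Abs_fps (\<lambda>_. 1)) n"
      using b_pos unfolding one_minus_X_power_nth
      by (auto simp: R_def le_div_geq of_nat_diff)
  qed
  moreover have "(1 - fps_X ^ 1) * Abs_fps (\<lambda>_. 1 :: int) = 1"
    by (rule fps_ext) (simp only: one_minus_X_power_nth, auto)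
  ultimately have P: "TP_denom 1 b g * ?P = 1"
    by (simp add: TP_denom_def mult.assoc)
  have "fps_nth (TP_denom 1 b g) 0 * 1 = 1"
    using b_pos g_pos by (simp add: TP_denom_def)
  then have inverse: "TP_denom 1 b g * fps_right_inverse (TP_denom 1 b g) 1 = 1"
    by (rule fps_right_inverse)
  have "fps_right_inverse (TP_denom 1 b g) 1 = fps_right_inverse (TP_denom 1 b g) 1 * (TP_denom 1 b g * ?P)"
    by (simp only: P mult_1_right)
  also have "\<dots> = TP_denom 1 b g * fps_right_inverse (TP_denom 1 b g) 1 * ?P"
    by (simp only: mult_ac)
  also have "\<dots> = ?P"
    by (simp only: inverse mult_1_left)
  finally show ?thesis .
qed

end

section \<open>Coefficients of the truncated theta series\<close>

lemma suminf_TP_term_nth: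
  assumes "n < N"
  shows "fps_nth (\<Sum>i. TP_term (k + i)) n = (\<Sum>i<N. fps_nth (TP_term (k + i)) n)"
proof -
  define S where "S = Abs_fps (\<lambda>n. \<Sum>i<Suc n. fps_nth (TP_term (k + i)) n)"
  have stable: "(\<Sum>i<m. fps_nth (TP_term (k + i)) n) = fps_nth S n" if "n < m" for m n
    unfolding S_def fps_nth_Abs_fps using that
    by (intro sum.mono_neutral_right) (auto simp: TP_term_nth_eq_0)
  have "(\<lambda>m. \<Sum>i<m. TP_term (k + i)) \<longlonglongrightarrow> S"
  proof (rule tendsto_fpsI)
    fix n
    show "\<forall>\<^sub>F m in sequentially. fps_nth (\<Sum>i<m. TP_term (k + i)) n = fps_nth S n"
      using eventually_gt_at_top[of n] by eventually_elim (simp add: fps_sum_nth stable)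
  qed
  then have "(\<lambda>i. TP_term (k + i)) sums S"
    by (simp only: sums_def)
  then have "(\<Sum>i. TP_term (k + i)) = S"
    by (rule sums_unique[symmetric])
  then show ?thesis using stable[OF assms] by simp
qed

lemma suminf_TP_term_split: "(\<Sum>i. TP_term (k + i)) = TP_term k + (\<Sum>i. TP_term (Suc k + i))"
proof (rule fps_ext)
  fix n
  show "fps_nth (\<Sum>i. TP_term (k + i)) n = fps_nth (TP_term k + (\<Sum>i. TP_term (Suc k + i))) n"
    unfolding fps_add_nth suminf_TP_term_nth[of n "Suc n" "Suc k", OF lessI]
      suminf_TP_term_nth[of n "Suc (Suc n)" k, OF less_SucI[OF lessI]]
    by (simp add: sum.lessThan_Suc_shift del: sum.lessThan_Suc)
qed

lemma pent_mono: "0 \<le> i \<Longrightarrow> i \<le> j \<Longrightarrow> pent i \<le> pent j"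
  unfolding pent_def by (intro zdiv_mono1 mult_mono) auto

lemma TP_term_eq:
  "TP_term j = (-1) ^ j * (fps_X ^ (j * (3 * j + 1) div 2) * (1 - fps_X ^ (2 * j + 1)))"
  by (simp add: TP_term_def mult.assoc)

lemma TP_eq_0:
  assumes "int n < pent (int k)"
  shows "TP \<alpha> \<beta> \<gamma> k n = 0"
proof -
  have "fps_nth (\<Sum>i. TP_term (k + i)) m = 0" if "m \<le> n" for m
  proof -
    have "fps_nth (TP_term (k + i)) m = 0" for i
    proof -
      have "int m < pent (int (k + i))"
        using pent_mono[of "int k" "int (k + i)"] assms that by simp
      then have "m < (k + i) * (3 * (k + i) + 1) div 2"
        by (simp only: pent_of_nat of_nat_less_iff)
      moreover have "TP_term (k + i) = fps_X ^ ((k + i) * (3 * (k + i) + 1) div 2) *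
          ((-1) ^ (k + i) * (1 - fps_X ^ (2 * (k + i) + 1)))"
        by (simp only: TP_term_eq mult.left_commute)
      ultimately show ?thesis by (simp only: fps_X_power_mult_nth if_True)
    qed
    then show ?thesis by (simp add: suminf_TP_term_nth[OF lessI])
  qed
  then show ?thesis
    unfolding TP_def TP_series_def by (simp add: fps_mult_nth[where n = n])
qed

text \<open>The prefactors of indices \<open>k\<close> and \<open>Suc k\<close> have opposite signs,
  so the common part of the two sums cancels and only the term of index \<open>k\<close>
  survives.\<close>

lemma TP_series_add_Suc:
  "TP_series \<alpha> \<beta> \<gamma> k + TP_series \<alpha> \<beta> \<gamma> (Suc k) =
    fps_X ^ (k * (3 * k + 1) div 2) *
      ((1 - fps_X ^ (2 * k + 1)) * fps_right_inverse (TP_denom \<alpha> \<beta> \<gamma>) 1)"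
proof -
  have sign: "(-1) ^ k * (-1) ^ k = (1 :: int fps)"
    by (simp flip: power_add)
  have "TP_series \<alpha> \<beta> \<gamma> k + TP_series \<alpha> \<beta> \<gamma> (Suc k) =
      (-1) ^ k * fps_right_inverse (TP_denom \<alpha> \<beta> \<gamma>) 1 * TP_term k"
    unfolding TP_series_def suminf_TP_term_split[of k] by (simp add: algebra_simps)
  also have "\<dots> = ((-1) ^ k * (-1) ^ k) * (fps_X ^ (k * (3 * k + 1) div 2) *
      ((1 - fps_X ^ (2 * k + 1)) * fps_right_inverse (TP_denom \<alpha> \<beta> \<gamma>) 1))"
    unfolding TP_term_eq by (simp only: mult_ac)
  finally show ?thesis by (simp only: sign mult_1)
qed

lemma map_const_upto: "map (\<lambda>_. x) [i..j] = replicate (nat (j - i + 1)) x"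
  by (simp add: map_replicate_const)

section \<open>Recursion in k and explicit lists of values\<close>

context three_part_denumerant
begin

text \<open>The extension by 0 to negative arguments makes the lag identities hold for every
  integer, without truncated subtraction.\<close>

definition T :: "nat \<Rightarrow> int \<Rightarrow> int" where
  "T k n = (if n < 0 then 0 else TP 1 b g k (nat n))"

lemma T_eq_0: "n < pent (int k) \<Longrightarrow> T k n = 0"
  by (auto simp: T_def intro: TP_eq_0)

lemma T_rec: "T k n = p (n - pent (int k)) - p (n - pent (int k) - (2 * int k + 1)) - T (Suc k) n"
proof (cases "n < 0")
  case True
  then show ?thesis using pent_ge[of "int k"] by (simp add: T_def denum_def)
next
  case False
  define w where "w = k * (3 * k + 1) div 2"
  have w: "pent (int k) = int w" by (simp only: pent_of_nat w_def)
  define m where "m = nat n"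
  have n: "n = int m" using False by (simp add: m_def)
  have "TP 1 b g k m + TP 1 b g (Suc k) m =
      fps_nth (TP_series 1 b g k + TP_series 1 b g (Suc k)) m"
    by (simp add: TP_def)
  also have "\<dots> = p (n - pent (int k)) - p (n - pent (int k) - (2 * int k + 1))"
  proof (cases "m < w")
    case True
    then show ?thesis
      unfolding TP_series_add_Suc w_def[symmetric] fps_X_power_mult_nth w n
      by (simp add: denum_def)
  next
    case False
    then obtain e where e: "m = w + e" by (metis le_Suc_ex not_less)
    have "fps_nth (TP_series 1 b g k + TP_series 1 b g (Suc k)) m =
        p (int e) - (if e < 2 * k + 1 then 0 else p (int (e - (2 * k + 1))))"
      unfolding TP_series_add_Suc w_def[symmetric] fps_X_power_mult_nth one_minus_X_power_nth
        inverse_denom e by simp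
    also have "(if e < 2 * k + 1 then 0 else p (int (e - (2 * k + 1)))) = p (int e - (2 * int k + 1))"
    proof (cases "e < 2 * k + 1")
      case True
      then show ?thesis by (simp add: denum_def)
    next
      case False
      then have "int (e - (2 * k + 1)) = int e - (2 * int k + 1)" by simp
      then show ?thesis using False by (simp only: if_False)
    qed
    finally show ?thesis by (simp add: w n e)
  qed
  finally show ?thesis by (simp add: T_def n)
qed

text \<open>The coefficients of 1 / ((1 - q) (1 - q^b)).\<close>

definition r :: "int \<Rightarrow> int" where
  "r m = (if m < 0 then 0 else m div int b + 1)"

lemma p_diff: "p m - p (m - int g) = r m"
  using p_lag[of m] by (auto simp: r_def denum_def)

lemma r_diff: "r m - r (m - int b) = (if m < 0 then 0 else 1)"
proof (cases "m < int b")
  case True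
  then show ?thesis by (simp add: r_def)
next
  case False
  moreover have "m div int b = (m - int b) div int b + 1"
    using b_pos div_add_self2[of "int b" "m - int b"] by simp
  ultimately show ?thesis by (simp add: r_def)
qed

text \<open>Here the denominator factor 1 - q^g is cancelled; \<open>U\<close> cancels 1 - q^b as
  well and leaves only 1 - q.\<close>

definition V :: "nat \<Rightarrow> int \<Rightarrow> int" where
  "V k n = T k n - T k (n - int g)"

definition U :: "nat \<Rightarrow> int \<Rightarrow> int" where
  "U k n = V k n - V k (n - int b)"

lemma V_rec: "V k n = r (n - pent (int k)) - r (n - pent (int k) - (2 * int k + 1)) - V (Suc k) n"
  unfolding V_def p_diff[symmetric] T_rec[of k n] T_rec[of k "n - int g"]
  by (simp add: algebra_simps)

lemma U_rec: "U k n = (if n < pent (int k) then 0 else 1) -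
    (if n < pent (int k) + (2 * int k + 1) then 0 else 1) - U (Suc k) n"
proof -
  have "U k n = (r (n - pent (int k)) - r (n - pent (int k) - int b)) -
      (r (n - pent (int k) - (2 * int k + 1)) - r (n - pent (int k) - (2 * int k + 1) - int b)) -
      U (Suc k) n"
    unfolding U_def V_rec[of k n] V_rec[of k "n - int b"] by (simp add: algebra_simps)
  then show ?thesis unfolding r_diff by auto
qed

lemma V_eq_0: "n < pent (int k) \<Longrightarrow> V k n = 0"
  by (simp add: V_def T_eq_0)

lemma U_eq_0: "n < pent (int k) \<Longrightarrow> U k n = 0"
  by (simp add: U_def V_eq_0)

text \<open>By \<open>U_rec\<close>, \<open>U k\<close> is 1 on the first 2k + 1 places from
  \<open>pent k\<close>, 0 on the next k + 1, and from \<open>pent (k + 1)\<close> on equals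
  \<open>- U (Suc k)\<close>. The factor \<open>e\<close> carries this sign through the
  induction.\<close>

lemma map_U: "map (\<lambda>n. e * U k n) [pent (int k)..pent (int (k + m)) - 1] = blocks e (int k) m"
proof (induction m arbitrary: e k)
  case 0
  then show ?case by simp
next
  case (Suc m)
  let ?a = "pent (int k)" and ?b = "pent (int k) + (2 * int k + 1)" and ?c = "pent (int (Suc k))"
    and ?d = "pent (int (k + Suc m))"
  have c: "?c = pent (int k) + 3 * int k + 2" using pent_Suc[of "int k"] by (simp add: add.commute)
  have d: "?c \<le> ?d" by (rule pent_mono) auto
  have "[?a..?d - 1] = [?a..?b - 1] @ [?b..?c - 1] @ [?c..?d - 1]"
  proof -
    have "[?a..?d - 1] = [?a..?b - 1] @ [?b..?d - 1]"
      using c d by (intro upto_split1) auto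
    moreover have "[?b..?d - 1] = [?b..?c - 1] @ [?c - 1 + 1..?d - 1]"
      using c d by (intro upto_split2) auto
    ultimately show ?thesis by (simp only: diff_add_cancel)
  qed
  moreover have "map (\<lambda>n. e * U k n) [?a..?b - 1] = map (\<lambda>_. e) [1..2 * int k + 1]"
  proof -
    have "map (\<lambda>n. e * U k n) [?a..?b - 1] = map (\<lambda>_. e) [?a..?b - 1]"
      using c by (intro map_cong refl) (auto simp: U_rec[of k] U_eq_0)
    then show ?thesis by (simp add: map_const_upto)
  qed
  moreover have "map (\<lambda>n. e * U k n) [?b..?c - 1] = map (\<lambda>_. 0) [1..int k + 1]"
  proof -
    have "map (\<lambda>n. e * U k n) [?b..?c - 1] = map (\<lambda>_. 0) [?b..?c - 1]"
      by (intro map_cong refl) (auto simp: U_rec[of k] U_eq_0)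
    then show ?thesis using c by (simp add: map_const_upto)
  qed
  moreover have "map (\<lambda>n. e * U k n) [?c..?d - 1] = blocks (-e) (int k + 1) m"
  proof -
    have "map (\<lambda>n. e * U k n) [?c..?d - 1] = map (\<lambda>n. (-e) * U (Suc k) n) [?c..?d - 1]"
      using c by (intro map_cong refl) (auto simp: U_rec[of k])
    also have "\<dots> = blocks (-e) (int (Suc k)) m"
      using Suc[of "-e" "Suc k"] by (simp only: add_Suc_shift)
    finally show ?thesis by (simp add: add.commute)
  qed
  ultimately show ?case by simp
qed

text \<open>\<open>V\<close> is recovered from \<open>U\<close>, then \<open>T\<close> from
  \<open>V\<close>; the initial windows are zero because everything vanishes below
  \<open>pent k\<close>.\<close>

lemma map_T: "map (T k) [pent (int k)..pent (int (k + m)) - 1] = values_from b g (int k) m"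
proof -
  let ?a = "pent (int k)" and ?e = "pent (int (k + m)) - 1"
  have V0: "map (V k) [?a - int b..?a - 1] = replicate b 0"
  proof -
    have "map (V k) [?a - int b..?a - 1] = map (\<lambda>_. 0) [?a - int b..?a - 1]"
      by (intro map_cong refl) (auto simp: V_eq_0)
    then show ?thesis by (simp add: map_const_upto)
  qed
  have T0: "map (T k) [?a - int g..?a - 1] = replicate g 0"
  proof -
    have "map (T k) [?a - int g..?a - 1] = map (\<lambda>_. 0) [?a - int g..?a - 1]"
      by (intro map_cong refl) (auto simp: T_eq_0)
    then show ?thesis by (simp add: map_const_upto)
  qed
  have "map (V k) [?a..?e] = lag_sum (replicate b 0) (map (U k) [?a..?e])"
    using lag_sum_map[of ?a "V k" b "U k" ?e] b_pos by (simp add: V0 U_def)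
  moreover have "map (T k) [?a..?e] = lag_sum (replicate g 0) (map (V k) [?a..?e])"
    using lag_sum_map[of ?a "T k" g "V k" ?e] g_pos by (simp add: T0 V_def)
  ultimately show ?thesis using map_U[of 1 k m] by (simp add: values_from_def)
qed

end

section \<open>Polynomial inequalities: main term against tail and error\<close>

text \<open>For \<open>J - k\<close> even: the product with factor \<open>k\<close> bounds
  \<open>H n k / 4\<close> from below, \<open>- 2 * J * (J + 1)\<close> bounds a quarter of the tail
  from below, and the left side is a quarter of the accumulated error.\<close>

lemma quadratic_dominates_even:
  fixes k J R :: int
  assumes "7 \<le> R" "R \<le> 23" "k = 1 \<and> R + 1 \<le> J \<or> k = 2 \<and> 6 \<le> J \<or> 3 \<le> k \<and> k + 2 \<le> J"
  shows "R * (J - k + 1) < k * (3 * J * J + J + 8 - 3 * k * k) - 2 * J * (J + 1)"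
  using assms(3)
proof (elim disjE conjE)
  assume k: "k = 1" and "R + 1 \<le> J"
  \<comment> \<open>The right side is J^2 - J + 5 here, which exceeds R J for \<open>J\<close> at
    least \<open>R + 1\<close> but not for \<open>J = R\<close>; this fixes the range to be computed
    for \<open>k = 1\<close>.\<close>
  then have "(R + 1) * J \<le> J * J" using assms by (intro mult_right_mono) auto
  then show ?thesis unfolding k by (simp only: algebra_simps)
next
  assume k: "k = 2" and "6 \<le> J"
  have "R * (J - 1) \<le> 23 * (J - 1)" using assms \<open>6 \<le> J\<close> by (intro mult_right_mono) auto
  moreover have "6 * J \<le> J * J" using \<open>6 \<le> J\<close> by (intro mult_right_mono) auto
  ultimately show ?thesis using \<open>6 \<le> J\<close> unfolding k by (simp only: algebra_simps)
next
  assume "3 \<le> k" "k + 2 \<le> J"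
  \<comment> \<open>In \<open>a\<close> and \<open>t\<close>, with \<open>R\<close> replaced by 23,
    the difference of the sides has nonnegative coefficients and a positive constant term. The same
    happens in the two odd lemmas below.\<close>
  define a t where "a = k - 3" and "t = J - k - 2"
  have at: "a \<ge> 0" "t \<ge> 0" "k = a + 3" "J = a + t + 5"
    using \<open>3 \<le> k\<close> \<open>k + 2 \<le> J\<close> by (auto simp: a_def t_def)
  have "R * (J - k + 1) \<le> 23 * (J - k + 1)" using assms at by (intro mult_right_mono) auto
  moreover have "0 \<le> a * a" "0 \<le> a * t" "0 \<le> t * t" "0 \<le> a * (a * t)" "0 \<le> a * (t * t)" "0 \<le> a * (a * a)"
    using at by simp_all
  ultimately show ?thesis using at(1,2) unfolding at(3,4) by (simp only: algebra_simps)
qed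

text \<open>For \<open>J - k\<close> odd and only the first summand of index \<open>J\<close>
  active; a quarter of the tail is then at most \<open>- J * J + 8 * J + 25\<close>.\<close>

lemma quadratic_dominates_odd_block:
  fixes k J R :: int
  assumes "7 \<le> R" "R \<le> 23" "k = 1 \<and> R + 1 \<le> J \<or> k = 2 \<and> 6 \<le> J \<or> 3 \<le> k \<and> k + 1 \<le> J"
  shows "R * (J - k + 1) < k * (3 * J * J + J + 8 - 3 * k * k) + J * J - 8 * J - 25"
  using assms(3)
proof (elim disjE conjE)
  assume k: "k = 1" and "R + 1 \<le> J"
  then have "(R + 1) * J \<le> J * J" "8 * J \<le> J * J" using assms by (intro mult_right_mono; simp)+
  then show ?thesis using \<open>R + 1 \<le> J\<close> assms(1) unfolding k by (simp only: algebra_simps)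
next
  assume k: "k = 2" and "6 \<le> J"
  have "R * (J - 1) \<le> 23 * (J - 1)" using assms \<open>6 \<le> J\<close> by (intro mult_right_mono) auto
  moreover have "6 * J \<le> J * J" using \<open>6 \<le> J\<close> by (intro mult_right_mono) auto
  ultimately show ?thesis using \<open>6 \<le> J\<close> unfolding k by (simp only: algebra_simps)
next
  assume "3 \<le> k" "k + 1 \<le> J"
  define a t where "a = k - 3" and "t = J - k - 1"
  have at: "a \<ge> 0" "t \<ge> 0" "k = a + 3" "J = a + t + 4"
    using \<open>3 \<le> k\<close> \<open>k + 1 \<le> J\<close> by (auto simp: a_def t_def)
  have "R * (J - k + 1) \<le> 23 * (J - k + 1)" using assms at by (intro mult_right_mono) auto
  moreover have "0 \<le> a * a" "0 \<le> a * t" "0 \<le> t * t" "0 \<le> a * (a * t)" "0 \<le> a * (t * t)" "0 \<le> a * (a * a)"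
    using at by simp_all
  ultimately show ?thesis using at(1,2) unfolding at(3,4) by (simp only: algebra_simps)
qed

text \<open>For \<open>J - k\<close> odd and both summands of index \<open>J\<close> active. The
  offset of \<open>n\<close> enters main term and tail alike; \<open>6 * J + 12\<close> is its worst
  contribution.\<close>

lemma quadratic_dominates_odd_gap:
  fixes k J R :: int
  assumes "7 \<le> R" "R \<le> 23" "k = 1 \<and> R + 1 \<le> J \<or> k = 2 \<and> 6 \<le> J \<or> 3 \<le> k \<and> k + 1 \<le> J"
  shows "R * (J - k + 1) < k * (3 * J * J + J + 2 - 3 * k * k) + (J + 1) * (5 * J + 1) - (6 * J + 12) * (J + 1 - k)"
  using assms(3)
proof (elim disjE conjE)
  assume k: "k = 1" and "R + 1 \<le> J"
  then have "(R + 1) * J \<le> J * J" "8 * J \<le> J * J" using assms by (intro mult_right_mono; simp)+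
  then show ?thesis using \<open>R + 1 \<le> J\<close> assms(1) unfolding k by (simp only: algebra_simps)
next
  assume k: "k = 2" and "6 \<le> J"
  have "R * (J - 1) \<le> 23 * (J - 1)" using assms \<open>6 \<le> J\<close> by (intro mult_right_mono) auto
  moreover have "6 * J \<le> J * J" using \<open>6 \<le> J\<close> by (intro mult_right_mono) auto
  ultimately show ?thesis using \<open>6 \<le> J\<close> unfolding k by (simp only: algebra_simps)
next
  assume "3 \<le> k" "k + 1 \<le> J"
  define a t where "a = k - 3" and "t = J - k - 1"
  have at: "a \<ge> 0" "t \<ge> 0" "k = a + 3" "J = a + t + 4"
    using \<open>3 \<le> k\<close> \<open>k + 1 \<le> J\<close> by (auto simp: a_def t_def)
  have "R * (J - k + 1) \<le> 23 * (J - k + 1)" using assms at by (intro mult_right_mono) auto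
  moreover have "0 \<le> a * a" "0 \<le> a * t" "0 \<le> t * t" "0 \<le> a * (a * t)" "0 \<le> a * (t * t)" "0 \<le> a * (a * a)"
    using at by simp_all
  ultimately show ?thesis using at(1,2) unfolding at(3,4) by (simp only: algebra_simps)
qed

lemma ex_pent_bracket:
  assumes "pent (int k) \<le> n"
  obtains J where "k \<le> J" "pent (int J) \<le> n" "n < pent (int (Suc J))"
proof -
  define P where "P j \<longleftrightarrow> k \<le> j \<and> pent (int j) \<le> n" for j
  have "P k" using assms by (simp add: P_def)
  moreover have bound: "j \<le> nat n" if "P j" for j
    using that pent_ge[of "int j"] unfolding P_def by linarith
  ultimately have G: "P (GREATEST j. P j)" by (rule GreatestI_nat)
  moreover have "\<not> P (Suc (GREATEST j. P j))"
    using Greatest_le_nat[of P "Suc (GREATEST j. P j)", OF _ bound] by auto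
  ultimately show ?thesis
    using that[of "GREATEST j. P j"] by (auto simp: P_def)
qed

section \<open>Quadratic approximation and telescoping\<close>

context three_part_denumerant
begin

abbreviation "R \<equiv> c - l"

text \<open>Four times (m + s/2)^2, which keeps the square integral; \<open>H\<close> is scaled by 4
  to match.\<close>

definition Q :: "int \<Rightarrow> int" where
  "Q m = (2 * m + s) * (2 * m + s)"

definition H :: "int \<Rightarrow> int \<Rightarrow> int" where
  "H n j = 4 * j * (2 * n + s + 2 - 3 * j * j)"

lemma p_approx:
  assumes "m \<ge> 0"
  shows "4 * A * p m \<le> Q m + 4 * c - s * s" "Q m + 4 * l - s * s \<le> 4 * A * p m"
  using p_lower[OF assms] p_upper[OF assms] by (simp_all add: Q_def algebra_simps)

text \<open>The splitting into values of one function at \<open>j\<close> and \<open>j + 1\<close>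
  is what makes the alternating sum over \<open>j\<close> telescope.\<close>

lemma Q_diff: "Q (n - pent j) - Q (n - pent j - (2 * j + 1)) = H n j + H n (j + 1)"
proof -
  define w where "w = pent j"
  have "Q (n - w) - Q (n - w - (2 * j + 1)) = 4 * (2 * j + 1) * (2 * n - 2 * w + s - (2 * j + 1))"
    by (simp add: Q_def algebra_simps)
  also have "\<dots> = H n j + H n (j + 1)"
    unfolding w_def two_pent by (simp add: H_def algebra_simps)
  finally show ?thesis by (simp only: w_def)
qed

text \<open>What the cut-off of \<open>p\<close> at 0 leaves of the telescoping sum, at the last active index \<open>j\<close>.\<close>

definition tail :: "int \<Rightarrow> int \<Rightarrow> int" where
  "tail n j = Q (n - pent j) -
     (if n < pent j + (2 * j + 1) then 0 else Q (n - pent j - (2 * j + 1))) - H n j"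

text \<open>Downward induction from \<open>J\<close>: each application of \<open>T_rec\<close>
  cancels \<open>H n (k + 1)\<close>, flips the sign of the tail and adds an error of at most
  \<open>4 * R\<close>.\<close>

lemma T_approx:
  assumes "k \<le> J" "pent (int J) \<le> n" "n < pent (int (Suc J))"
  shows "\<bar>4 * A * T k n - H n (int k) - (-1) ^ (J - k) * tail n (int J)\<bar> \<le> 4 * R * (int J - int k + 1)"
  using assms(1)
proof (induction rule: inc_induct)
  case base
  have "4 * A * T J n = 4 * A * p (n - pent (int J)) - 4 * A * p (n - pent (int J) - (2 * int J + 1))"
    using assms(3) by (simp add: T_rec[of J] T_eq_0 algebra_simps)
  \<comment> \<open>If the second summand is cut off, the offset \<open>s * s\<close> of the first
    is not cancelled; \<open>centred\<close> places it between \<open>4 * l\<close> and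
    \<open>4 * c\<close>, so the error still stays within \<open>4 * R\<close>.\<close>
  moreover have "4 * A * p (n - pent (int J) - (2 * int J + 1)) = 0" if "n < pent (int J) + (2 * int J + 1)"
    using that by (simp add: denum_def)
  ultimately show ?case
    using p_approx[of "n - pent (int J)"] p_approx[of "n - pent (int J) - (2 * int J + 1)"]
      assms(2) centred by (auto simp: tail_def power2_eq_square)
next
  case (step k)
  have c: "pent (int (Suc k)) = pent (int k) + 3 * int k + 2"
    using pent_Suc[of "int k"] by (simp add: add.commute)
  \<comment> \<open>Below the last index both arguments are nonnegative, so no cut-off
    occurs.\<close>
  have "pent (int (Suc k)) \<le> pent (int J)" using step.hyps by (intro pent_mono) auto
  then have y: "n - pent (int k) \<ge> 0" "n - pent (int k) - (2 * int k + 1) \<ge> 0"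
    using c assms(2) by linarith+
  have "4 * A * T k n = 4 * A * p (n - pent (int k)) - 4 * A * p (n - pent (int k) - (2 * int k + 1))
      - 4 * A * T (Suc k) n"
    by (simp add: T_rec[of k] algebra_simps)
  moreover have "\<bar>4 * A * p (n - pent (int k)) - 4 * A * p (n - pent (int k) - (2 * int k + 1)) -
      (H n (int k) + H n (int k + 1))\<bar> \<le> 4 * R"
  proof -
    have "\<bar>u - v - h\<bar> \<le> 4 * R" if "u \<le> q + 4 * c - z" "q + 4 * l - z \<le> u"
      "v \<le> q' + 4 * c - z" "q' + 4 * l - z \<le> v" "q - q' = h" for u v q q' z h :: int
      using that by (simp add: abs_le_iff)
    from this[OF p_approx[OF y(1)] p_approx[OF y(2)] Q_diff] show ?thesis .
  qed
  moreover have "(-1) ^ (J - k) = - ((-1) ^ (J - Suc k) :: int)"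
  proof -
    have "J - k = Suc (J - Suc k)" using step.hyps by simp
    then show ?thesis by (simp only: power_Suc mult_minus1)
  qed
  moreover have "4 * R * (int J - int (Suc k) + 1) + 4 * R = 4 * R * (int J - int k + 1)"
    by (simp add: algebra_simps)
  moreover have "int (Suc k) = int k + 1" by simp
  ultimately show ?case using step.IH by (simp only:)
qed

lemma T_pos_top:
  assumes "k \<ge> 2" "pent (int k) \<le> n" "n < pent (int (Suc k))"
  shows "T k n > 0"
proof -
  have T: "T k n = p (n - pent (int k)) - p (n - pent (int k) - (2 * int k + 1))"
    using assms(3) by (simp add: T_rec[of k] T_eq_0)
  show ?thesis
  proof (cases "n < pent (int k) + (2 * int k + 1)")
    case True
    then have "p (n - pent (int k) - (2 * int k + 1)) = 0" by (simp add: denum_def)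
    then show ?thesis using T p_pos[of "n - pent (int k)"] assms(2) by simp
  next
    case False
    then show ?thesis
      using T p_increase[of "n - pent (int k) - (2 * int k + 1)" "2 * int k + 1"] assms(1) by simp
  qed
qed

end

section \<open>Sign of the coefficients\<close>

text \<open>The finite checks complement the estimates: for \<open>k = 1\<close> from
  \<open>pent 1 = 2\<close> to below \<open>pent (R + 1)\<close>, with \<open>zs\<close> the zeros,
  and for \<open>k = 2\<close> the four index steps from \<open>pent 2\<close> to below
  \<open>pent 6\<close>.\<close>

locale three_part_denumerant_checked = three_part_denumerant +
  fixes zs :: "int list"
  assumes spread_ge: "7 \<le> c - l"
    and first_values: "\<forall>(n, t)\<in>set (zip [2..pent (c - l + 1) - 1] (values_from b g 1 (nat (c - l)))).
      0 \<le> t \<and> (t = 0 \<longleftrightarrow> n \<in> set zs)"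
    and zeros: "\<forall>n\<in>set zs. n < pent (c - l + 1)"
    and second_values: "\<forall>t\<in>set (values_from b g 2 4). 0 < t"
begin

lemma T_pos_large:
  assumes kJ: "k = 1 \<and> R + 1 \<le> int J \<or> k = 2 \<and> 6 \<le> J \<or> 3 \<le> k \<and> k + 1 \<le> J"
    and J: "pent (int J) \<le> n" "n < pent (int (Suc J))"
  shows "T k n > 0"
proof -
  define x where "x = n - pent (int J)"
  have c: "pent (int (Suc J)) = pent (int J) + 3 * int J + 2"
    using pent_Suc[of "int J"] by (simp add: add.commute)
  have x: "0 \<le> x" "x \<le> 3 * int J + 1" using J c by (auto simp: x_def)
  have n: "2 * n = 2 * x + 3 * int J * int J + int J"
    using two_pent[of "int J"] by (simp add: x_def algebra_simps)
  have H: "H n j = 4 * (j * (2 * x + 3 * int J * int J + int J + s + 2 - 3 * j * j))" for j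
    using n by (simp add: H_def algebra_simps)
  have tail_block: "tail n (int J) = (2 * x + s - 2 * int J) * (2 * x + s - 2 * int J) - 8 * int J * (int J + 1)"
    if "x \<le> 2 * int J"
  proof -
    have "tail n (int J) = Q x - H n (int J)" using that by (simp add: tail_def x_def)
    then show ?thesis unfolding H Q_def by (simp add: algebra_simps)
  qed
  have tail_gap: "tail n (int J) = 4 * ((int J + 1) * (2 * x - 5 * int J + s - 1))"
    if "\<not> x \<le> 2 * int J"
  proof -
    have "tail n (int J) = H n (int J + 1)"
      \<comment> \<open>With both summands active the pair telescopes fully and leaves its upper
        half.\<close>
      using that Q_diff[of n "int J"] by (simp add: tail_def x_def)
    then show ?thesis unfolding H by (simp add: algebra_simps)
  qed
  have kJ': "k \<le> J" "k \<ge> 1" using kJ spread_ge by auto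
  have R: "7 \<le> R" "R \<le> 23" using spread_ge spread by auto
  have H8: "4 * (int k * (3 * int J * int J + int J + 8 - 3 * int k * int k)) \<le> H n (int k)"
    unfolding H using x span kJ' by (intro mult_left_mono) auto
  have "4 * R * (int J - int k + 1) < H n (int k) + (-1) ^ (J - k) * tail n (int J)"
  proof (cases "even (J - k)")
    case True
    \<comment> \<open>Parity improves \<open>k + 1 \<le> J\<close> to
      \<open>k + 2 \<le> J\<close>.\<close>
    then have "J \<noteq> Suc k" by auto
    then have "int k = 1 \<and> R + 1 \<le> int J \<or> int k = 2 \<and> 6 \<le> int J \<or> 3 \<le> int k \<and> int k + 2 \<le> int J"
      using kJ by auto
    from quadratic_dominates_even[OF R this]
    have "4 * R * (int J - int k + 1) < H n (int k) - 8 * int J * (int J + 1)"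
      using H8 by linarith
    moreover have "- (8 * int J * (int J + 1)) \<le> tail n (int J)"
    proof (cases "x \<le> 2 * int J")
      case True
      then show ?thesis by (simp add: tail_block)
    next
      case False
      then have "(int J + 1) * (- 2 * int J) \<le> (int J + 1) * (2 * x - 5 * int J + s - 1)"
        using span kJ' by (intro mult_left_mono) auto
      then show ?thesis using False by (simp add: tail_gap algebra_simps)
    qed
    ultimately show ?thesis using True by simp
  next
    case False
    have kJi: "int k = 1 \<and> R + 1 \<le> int J \<or> int k = 2 \<and> 6 \<le> int J \<or> 3 \<le> int k \<and> int k + 1 \<le> int J"
      using kJ by auto
    have "4 * R * (int J - int k + 1) < H n (int k) - tail n (int J)"
    proof (cases "x \<le> 2 * int J")
      case True
      \<comment> \<open>Here 0 \<le> x \<le> 2 J and s \<le> 10.\<close>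
      have "\<bar>2 * x + s - 2 * int J\<bar> \<le> \<bar>2 * int J + 10\<bar>" using True x span by auto
      then have "(2 * x + s - 2 * int J) * (2 * x + s - 2 * int J) \<le> (2 * int J + 10) * (2 * int J + 10)"
        by (simp only: abs_le_square_iff power2_eq_square)
      then have "tail n (int J) \<le> 4 * (- (int J * int J) + 8 * int J + 25)"
        using True by (simp add: tail_block algebra_simps)
      moreover have "4 * (r * d) < h - t" if "t \<le> 4 * (- z + 8 * j + 25)" "r * d < e + z - 8 * j - 25"
        "4 * e \<le> h" for r d h t z j e :: int
        using that by simp
      ultimately show ?thesis
        using quadratic_dominates_odd_block[OF R kJi] H8 by (simp only: mult.assoc[of 4])
    next
      case False
      \<comment> \<open>The difference of main term and tail decreases in \<open>x\<close>, so the
        extremes x = 3 J + 1 and s = 10 are the worst case.\<close>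
      have "(2 * x + s) * (int J + 1 - int k) \<le> (6 * int J + 12) * (int J + 1 - int k)"
        using x span kJ' by (intro mult_right_mono) auto
      moreover have "H n (int k) - tail n (int J) =
          4 * (int k * (3 * int J * int J + int J + 2 - 3 * int k * int k) + (int J + 1) * (5 * int J + 1)
            - (2 * x + s) * (int J + 1 - int k))"
        unfolding tail_gap[OF False] H by (simp add: algebra_simps)
      moreover have "4 * (r * d) < h" if "m \<le> M" "h = 4 * (e - m)" "r * d < e - M" for r d h e m M :: int
        using that by simp
      ultimately show ?thesis
        using quadratic_dominates_odd_gap[OF R kJi] by (simp only: mult.assoc[of 4])
    qed
    then show ?thesis using False by simp
  qed
  then have "0 < A * T k n"
    using T_approx[OF kJ'(1) J] by linarith
  then show ?thesis using A_pos zero_less_mult_pos by blast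
qed

lemma T_two_pos_small:
  assumes "pent 2 \<le> n" "n < pent 6"
  shows "T 2 n > 0"
proof -
  have "T 2 n \<in> set (map (T 2) [pent (int 2)..pent (int (2 + 4)) - 1])"
    using assms by auto
  then show ?thesis using second_values unfolding map_T by simp
qed

lemma T_one_small:
  assumes "pent 1 \<le> n" "n < pent (R + 1)"
  shows "0 \<le> T 1 n \<and> (T 1 n = 0 \<longleftrightarrow> n \<in> set zs)"
proof -
  have "int (1 + nat R) = R + 1" using spread by simp
  moreover have "pent 1 = 2" by (simp add: pent_def)
  ultimately have "map (T 1) [2..pent (R + 1) - 1] = values_from b g 1 (nat R)"
    using map_T[of 1 "nat R"] by (simp only: of_nat_1)
  moreover have "(n, T 1 n) \<in> set (zip [2..pent (R + 1) - 1] (map (T 1) [2..pent (R + 1) - 1]))"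
    using assms by (auto simp: zip_map2 zip_same pent_def)
  ultimately show ?thesis using first_values by auto
qed

theorem T_sign:
  assumes "k \<ge> 1" "pent (int k) \<le> n"
  shows "0 \<le> T k n" "T k n = 0 \<longleftrightarrow> k = 1 \<and> n \<in> set zs"
proof -
  have pos: "T k n > 0" if "k \<noteq> 1 \<or> pent (R + 1) \<le> n"
  proof -
    obtain J where J: "k \<le> J" "pent (int J) \<le> n" "n < pent (int (Suc J))"
      using ex_pent_bracket[OF assms(2)] .
    consider "k = 1" | "k = 2" "n < pent 6" | "k = 2" "pent 6 \<le> n" | "k \<ge> 3" "J = k" | "k \<ge> 3" "k + 1 \<le> J"
      using assms(1) J(1) by force
    then show ?thesis
    proof cases
      case 1
      have "R + 1 < int (Suc J)"
        using that 1 J(3) pent_mono[of "int (Suc J)" "R + 1"] by force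
      then show ?thesis using 1 J by (intro T_pos_large[of k J]) auto
    next
      case 2
      then show ?thesis using T_two_pos_small assms(2) by simp
    next
      case 3
      have "6 < int (Suc J)"
        using 3 J(3) pent_mono[of "int (Suc J)" 6] by force
      then show ?thesis using 3 J by (intro T_pos_large[of k J]) auto
    next
      case 4
      then show ?thesis using J by (intro T_pos_top) auto
    next
      case 5
      then show ?thesis using J by (intro T_pos_large[of k J]) auto
    qed
  qed
  have "0 \<le> T k n \<and> (T k n = 0 \<longleftrightarrow> k = 1 \<and> n \<in> set zs)"
  proof (cases "k \<noteq> 1 \<or> pent (R + 1) \<le> n")
    case True
    \<comment> \<open>For \<open>k = 1\<close> beyond the computed range, \<open>zeros\<close>
      excludes \<open>n\<close> from \<open>zs\<close>, in agreement with positivity.\<close>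
    then show ?thesis using pos zeros by force
  next
    case False
    then show ?thesis using T_one_small assms(2) by simp
  qed
  then show "0 \<le> T k n" "T k n = 0 \<longleftrightarrow> k = 1 \<and> n \<in> set zs" by blast+
qed

lemma TP_sign:
  assumes "k \<ge> 1" "n \<ge> k * (3 * k + 1) div 2"
  shows "0 \<le> TP 1 b g k n" "TP 1 b g k n = 0 \<longleftrightarrow> k = 1 \<and> int n \<in> set zs"
proof -
  have "pent (int k) \<le> int n" using assms(2) by (simp only: pent_of_nat of_nat_le_iff)
  then show "0 \<le> TP 1 b g k n" "TP 1 b g k n = 0 \<longleftrightarrow> k = 1 \<and> int n \<in> set zs"
    using T_sign[of k "int n"] assms(1) by (simp_all add: T_def)
qed

end

section \<open>The five triples, by evaluation\<close>

lemmas three_part_denumerant_checked_unfold =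
  three_part_denumerant_checked_def three_part_denumerant_checked_axioms_def
  three_part_denumerant_def power2_eq_square

text \<open>The arguments are b, g, c, l and the zeros for \<open>k = 1\<close>. In the five
  instances \<open>c - l\<close> is 7, 13, 23, 20 and 22, the source of the bounds 7 and 23 on
  \<open>R\<close>.\<close>

lemma checked_1_2_3: "three_part_denumerant_checked 2 3 12 5 [13]"
  unfolding three_part_denumerant_checked_unfold by code_simp

lemma checked_1_2_5: "three_part_denumerant_checked 2 5 20 7 [11, 13, 15]"
  unfolding three_part_denumerant_checked_unfold by code_simp

lemma checked_1_2_7: "three_part_denumerant_checked 2 7 32 9 [7, 9, 11, 13, 14, 15]"
  unfolding three_part_denumerant_checked_unfold by code_simp

lemma checked_1_3_4: "three_part_denumerant_checked 3 4 24 4 [11, 13, 14, 17, 38, 41]"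
  unfolding three_part_denumerant_checked_unfold by code_simp

lemma checked_1_3_5: "three_part_denumerant_checked 3 5 30 8 [10, 11, 13, 14, 16, 37]"
  unfolding three_part_denumerant_checked_unfold by code_simp

lemmas TP_sign_cases =
  three_part_denumerant_checked.TP_sign[OF checked_1_2_3]
  three_part_denumerant_checked.TP_sign[OF checked_1_2_5]
  three_part_denumerant_checked.TP_sign[OF checked_1_2_7]
  three_part_denumerant_checked.TP_sign[OF checked_1_3_4]
  three_part_denumerant_checked.TP_sign[OF checked_1_3_5]

theorem theorem1p1:
  fixes \<alpha> \<beta> \<gamma> :: nat
  assumes "(\<alpha>, \<beta>, \<gamma>) \<in> {(1,2,3), (1,2,5), (1,2,7), (1,3,4), (1,3,5)}"
  shows "(\<forall>k n. k \<ge> 1 \<and> n \<ge> k * (3 * k + 1) div 2 \<longrightarrow>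
           TP \<alpha> \<beta> \<gamma> k n \<ge> 0 \<and>
           (TP \<alpha> \<beta> \<gamma> k n = 0 \<longleftrightarrow>
              k = 1 \<and>
              ((\<alpha>, \<beta>, \<gamma>) = (1,2,3) \<and> n \<in> {13} \<or>
               (\<alpha>, \<beta>, \<gamma>) = (1,2,5) \<and> n \<in> {11,13,15} \<or>
               (\<alpha>, \<beta>, \<gamma>) = (1,2,7) \<and> n \<in> {7,9,11,13,14,15} \<or>
               (\<alpha>, \<beta>, \<gamma>) = (1,3,4) \<and> n \<in> {11,13,14,17,38,41} \<or>
               (\<alpha>, \<beta>, \<gamma>) = (1,3,5) \<and> n \<in> {10,11,13,14,16,37}))) \<and>
         (\<forall>k n. k > 1 \<and> n \<ge> k * (3 * k + 1) div 2 \<longrightarrow> TP \<alpha> \<beta> \<gamma> k n > 0)"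
proof -
  define Z where "Z = (\<lambda>n. (\<alpha>, \<beta>, \<gamma>) = (1,2,3) \<and> n \<in> {13} \<or>
               (\<alpha>, \<beta>, \<gamma>) = (1,2,5) \<and> n \<in> {11,13,15} \<or>
               (\<alpha>, \<beta>, \<gamma>) = (1,2,7) \<and> n \<in> {7,9,11,13,14,15} \<or>
               (\<alpha>, \<beta>, \<gamma>) = (1,3,4) \<and> n \<in> {11,13,14,17,38,41} \<or>
               (\<alpha>, \<beta>, \<gamma>) = (1,3,5) \<and> n \<in> {10,11,13,14,16,37::nat})"
  have sign: "0 \<le> TP \<alpha> \<beta> \<gamma> k n \<and> (TP \<alpha> \<beta> \<gamma> k n = 0 \<longleftrightarrow> k = 1 \<and> Z n)"
    if "k \<ge> 1" "n \<ge> k * (3 * k + 1) div 2" for k n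
    using assms TP_sign_cases[OF that] unfolding Z_def
    by (elim insertE emptyE) (simp_all only: prod.inject, simp_all)
  moreover have "0 < TP \<alpha> \<beta> \<gamma> k n" if "k > 1" "n \<ge> k * (3 * k + 1) div 2" for k n
    using sign[of k n] that by force
  ultimately show ?thesis unfolding Z_def by blast
qed

end
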